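(* Let $m,n\ge 2$ and let $S=S(m,n;\underline{t})$ be the special Lie superalgebra over a field $\mathbb{F}$ of characteristic $p>2$. Let $\phi$ be a skew-symmetric super-biderivation of $S$. For any $k_0,i_0\in Y_0$, $k_1\in Y_1$ with $i_0\neq k_0$, there is an element $\lambda_{k_0k_1}\in\mathbb{F}$, depending (for given $\phi$) only on $k_0$ and $k_1$, such that $$\phi(D_{k_0k_1}(x_{k_0}x_{k_1}),D_{k_0i_0}(x_{i_0}))=\lambda_{k_0k_1}[D_{k_0k_1}(x_{k_0}x_{k_1}),D_{k_0i_0}(x_{i_0})].$$
   Context: Conventions. $\mathbb{F}$ is a field of characteristic $p>2$; $\mathbb{Z}_2=\{\bar 0,\bar 1\}$; $\mathrm{d}(x)$ denotes the $\mathbb{Z}_2$-degree (parity) of $x$, and whenever $\mathrm{d}(x)$ appears, $x$ is assumed $\mathbb{Z}_2$-homogeneous. A Lie superalgebra is a superspace $L=L_{\bar 0}\oplus L_{\bar 1}$ with an even bilinear bracket satisfying $[x,y]=-(-1)^{\mathrm{d}(x)\mathrm{d}(y)}[y,x]$ and $[x,[y,z]]=[[x,y],z]+(-1)^{\mathrm{d}(x)\mathrm{d}(y)}[y,[x,z]]$. Super-biderivations. A bilinear map $\phi:L\times L\to L$ is $\mathbb{Z}_2$-homogeneous of degree $\gamma=\mathrm{d}(\phi)\in\mathbb{Z}_2$ if $\phi(L_\alpha,L_\beta)\subset L_{\alpha+\beta+\gamma}$ for all $\alpha,\beta\in\mathbb{Z}_2$. A homogeneous bilinear map $\phi$ is a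 skew-symmetric super-biderivation of $L$ if for all homogeneous $x,y,z\in L$ $$\phi(x,[y,z])=[\phi(x,y),z]+(-1)^{(\mathrm{d}(\phi)+\mathrm{d}(x))\mathrm{d}(y)}[y,\phi(x,z)],$$ $$\phi(x,y)=-(-1)^{\mathrm{d}(\phi)\mathrm{d}(x)+\mathrm{d}(\phi)\mathrm{d}(y)+\mathrm{d}(x)\mathrm{d}(y)}\phi(y,x).$$ The algebra $S(m,n;\underline{t})$. Let $\underline{t}=(t_1,\dots,t_m)$ be an $m$-tuple of positive integers, $s=m+n$, $Y_0=\{1,\dots,m\}$, $Y_1=\{m+1,\dots,s\}$, $Y=Y_0\cup Y_1$, and $\tau(i)=\bar 0$ for $i\in Y_0$, $\tau(i)=\bar 1$ for $i\in Y_1$. Let $\pi_i=p^{t_i}-1$ and $A=\{\alpha\in\mathbb{N}^m\mid 0\le\alpha_i\le\pi_i\}$; let $B$ be the set of strictly increasing tuples $u=\langle i_1,\dots,i_k\rangle$ in $Y_1$ ($0\le k\le n$), with $x^u=x_{i_1}\cdots x_{i_k}$ and $x^{\varnothing}=1$. Let $\Lambda(m,n;\underline{t})$ be the associative superalgebra with basis $\{x^{(\alpha)}x^u\mid\alpha\in A,u\in B\}$, where $x^{(\alpha)}x^{(\beta)}=\binom{\alpha+\beta}{\alpha}x^{(\alpha+\beta)}$ with $\binom{\alpha}{\beta}=\prod_i\binom{\alpha_i}{\beta_i}$ (the product is $0$ when $\alpha+\beta\notin A$), $x_ix_j=-x_jx_i$ for $i,j\in Y_1$ (so $x_i^2=0$),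 $x^{(\alpha)}x_j=x_jx^{(\alpha)}$ for $j\in Y_1$; the $x^{(\alpha)}$ are even and the $x_j$, $j\in Y_1$, odd. For $i\in Y_0$ write $x_i=x^{(\varepsilon_i)}$, with $\varepsilon_i$ the $i$-th unit vector. Let $D_i$ ($i\in Y$) be the superderivation of parity $\tau(i)$ given by $D_i(x^{(\alpha)}x^u)=x^{(\alpha-\varepsilon_i)}x^u$ for $i\in Y_0$ (zero if $\alpha_i=0$), and $D_i(x^{(\alpha)}x^u)=x^{(\alpha)}\partial_i(x^u)$ for $i\in Y_1$, where $\partial_i$ is the odd superderivation of the Grassmann algebra with $\partial_i(x_j)=\delta_{ij}$. Let $W(m,n;\underline{t})=\{\sum_{i\in Y}f_iD_i\mid f_i\in\Lambda(m,n;\underline{t})\}$ with bracket $[fD_i,gD_j]=fD_i(g)D_j-(-1)^{\mathrm{d}(fD_i)\mathrm{d}(gD_j)}gD_j(f)D_i$. For $i,j\in Y$ and homogeneous $f\in\Lambda(m,n;\underline{t})$ put $$D_{ij}(f)=-(-1)^{\mathrm{d}(f)(\tau(i)+\tau(j))}D_j(f)D_i+(-1)^{\tau(i)\tau(j)}D_i(f)D_j,$$ extended linearly in $f$. Then $S=S(m,n;\underline{t})=\mathrm{span}_{\mathbb{F}}\{D_{ij}(f)\mid i,j\in Y,\ f\in\Lambda(m,n;\underline{t})\}$, a finite-dimensional simple Lie sub-superalgebra of $W(m,n;\underline{t})$. *)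

theory Defs
  imports Complex_Main "HOL-Library.Z2" "HOL-Library.Function_Algebras"
begin

text \<open>
  The group \<open>\<int>\<^sub>2\<close> of parities is the type \<^typ>\<open>bit\<close>, and \<open>ksign e\<close> is \<open>(-1)\<^sup>e\<close>.
\<close>

definition ksign :: "bit \<Rightarrow> 'a::ring_1"
  where "ksign e = (if e = 0 then 1 else - 1)"


subsection \<open>Skew-symmetric super-biderivations\<close>

definition bilinear_on ::
  "('a::field \<Rightarrow> 'v \<Rightarrow> 'v) \<Rightarrow> 'v::ab_group_add set \<Rightarrow> ('v \<Rightarrow> 'v \<Rightarrow> 'v) \<Rightarrow> bool"
  where "bilinear_on scl L \<phi> \<longleftrightarrow>
    (\<forall>x\<in>L. \<forall>y\<in>L. \<phi> x y \<in> L) \<and>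
    (\<forall>x\<in>L. \<forall>y\<in>L. \<forall>z\<in>L. \<phi> (x + y) z = \<phi> x z + \<phi> y z \<and> \<phi> x (y + z) = \<phi> x y + \<phi> x z) \<and>
    (\<forall>c. \<forall>x\<in>L. \<forall>y\<in>L. \<phi> (scl c x) y = scl c (\<phi> x y) \<and> \<phi> x (scl c y) = scl c (\<phi> x y))"

text \<open>
  \<open>L\<close> is the underlying space of a Lie superalgebra with scalar multiplication \<open>scl\<close>, bracket \<open>br\<close>
  and homogeneous components \<open>hom 0\<close> and \<open>hom 1\<close>; \<open>\<gamma>\<close> is the parity of \<open>\<phi>\<close>.  Values of \<open>\<phi>\<close>
  outside \<open>L\<close> are unconstrained.
\<close>

definition skew_super_biderivation ::
  "('a::field \<Rightarrow> 'v \<Rightarrow> 'v) \<Rightarrow> 'v::ab_group_add set \<Rightarrow> (bit \<Rightarrow> 'v set) \<Rightarrow> ('v \<Rightarrow> 'v \<Rightarrow> 'v)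
    \<Rightarrow> bit \<Rightarrow> ('v \<Rightarrow> 'v \<Rightarrow> 'v) \<Rightarrow> bool"
  where "skew_super_biderivation scl L hom br \<gamma> \<phi> \<longleftrightarrow>
    bilinear_on scl L \<phi> \<and>
    (\<forall>a b. \<forall>x\<in>hom a. \<forall>y\<in>hom b. \<phi> x y \<in> hom (a + b + \<gamma>)) \<and>
    (\<forall>a b c. \<forall>x\<in>hom a. \<forall>y\<in>hom b. \<forall>z\<in>hom c.
       \<phi> x (br y z) = br (\<phi> x y) z + scl (ksign ((\<gamma> + a) * b)) (br y (\<phi> x z))) \<and>
    (\<forall>a b. \<forall>x\<in>hom a. \<forall>y\<in>hom b.
       \<phi> x y = - scl (ksign (\<gamma> * a + \<gamma> * b + a * b)) (\<phi> y x))"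


subsection \<open>The superalgebra \<open>\<Lambda>(m,n;t)\<close>\<close>

definition Y0 :: "nat \<Rightarrow> nat set"
  where "Y0 m = {1..m}"

definition Y1 :: "nat \<Rightarrow> nat \<Rightarrow> nat set"
  where "Y1 m n = {m + 1..m + n}"

definition Y :: "nat \<Rightarrow> nat \<Rightarrow> nat set"
  where "Y m n = Y0 m \<union> Y1 m n"

definition tau :: "nat \<Rightarrow> nat \<Rightarrow> bit"
  where "tau m i = (if i \<in> Y0 m then 0 else 1)"

text \<open>
  The basis monomial \<open>x\<^sup>(\<^sup>\<alpha>\<^sup>) x\<^sup>u\<close> is encoded by the pair \<open>(\<alpha>, u)\<close>, where \<open>\<alpha>\<close> vanishes off \<open>Y0 m\<close> and the
  strictly increasing tuple \<open>u\<close> is represented by the set of its entries.  An element of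
  \<open>\<Lambda>(m,n;t)\<close> is its coefficient function with respect to this basis, extended by zero to all
  pairs; addition is the pointwise one.  (The pointwise product of functions is not used on
  coefficient functions; the product of \<open>\<Lambda>(m,n;t)\<close> is \<open>lmul\<close> below.)
\<close>

type_synonym mon = "(nat \<Rightarrow> nat) \<times> nat set"
type_synonym 'a lam = "mon \<Rightarrow> 'a"

definition expo :: "nat \<Rightarrow> nat \<Rightarrow> (nat \<Rightarrow> nat) \<Rightarrow> (nat \<Rightarrow> nat) set"
  where "expo p m t = {\<alpha>. (\<forall>i\<in>Y0 m. \<alpha> i \<le> p ^ t i - 1) \<and> (\<forall>i. i \<notin> Y0 m \<longrightarrow> \<alpha> i = 0)}"

definition mbasis :: "nat \<Rightarrow> nat \<Rightarrow> nat \<Rightarrow> (nat \<Rightarrow> nat) \<Rightarrow> mon set"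
  where "mbasis p m n t = expo p m t \<times> Pow (Y1 m n)"

definition monomial :: "mon \<Rightarrow> 'a::field lam"
  where "monomial b = (\<lambda>c. if c = b then 1 else 0)"

definition lscale :: "'a::field \<Rightarrow> 'a lam \<Rightarrow> 'a lam"
  where "lscale c f = (\<lambda>b. c * f b)"

definition Lam :: "nat \<Rightarrow> nat \<Rightarrow> (nat \<Rightarrow> nat) \<Rightarrow> 'a::field lam set"
  where "Lam m n t = {f. \<forall>b. b \<notin> mbasis CHAR('a) m n t \<longrightarrow> f b = 0}"

definition mpar :: "mon \<Rightarrow> bit"
  where "mpar b = of_nat (card (snd b))"

text \<open>The component of parity \<open>e\<close> of an element.\<close>

definition hpart :: "bit \<Rightarrow> 'a::field lam \<Rightarrow> 'a lam"
  where "hpart e f = (\<lambda>b. if mpar b = e then f b else 0)"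

definition Lam_hom :: "nat \<Rightarrow> nat \<Rightarrow> (nat \<Rightarrow> nat) \<Rightarrow> bit \<Rightarrow> 'a::field lam set"
  where "Lam_hom m n t e = {f \<in> Lam m n t. hpart e f = f}"

text \<open>
  The sign in the product counts the transpositions needed to sort the concatenation of two
  increasing tuples.
\<close>

definition mul_mon :: "nat \<Rightarrow> (nat \<Rightarrow> nat) \<Rightarrow> mon \<Rightarrow> mon \<Rightarrow> 'a::field lam"
  where "mul_mon m t = (\<lambda>(\<alpha>, u) (\<beta>, v).
    if (\<lambda>i. \<alpha> i + \<beta> i) \<in> expo CHAR('a) m t \<and> u \<inter> v = {}
    then lscale (of_nat (\<Prod>i\<in>Y0 m. (\<alpha> i + \<beta> i) choose \<alpha> i) *
                 (- 1) ^ card {(i, j). i \<in> u \<and> j \<in> v \<and> j < i})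
           (monomial (\<lambda>i. \<alpha> i + \<beta> i, u \<union> v))
    else 0)"

definition lmul :: "nat \<Rightarrow> nat \<Rightarrow> (nat \<Rightarrow> nat) \<Rightarrow> 'a::field lam \<Rightarrow> 'a lam \<Rightarrow> 'a lam"
  where "lmul m n t f g =
    (\<Sum>a\<in>mbasis CHAR('a) m n t. \<Sum>b\<in>mbasis CHAR('a) m n t. lscale (f a * g b) (mul_mon m t a b))"

text \<open>The generator \<open>x\<^sub>i\<close>, which is \<open>x\<^sup>(\<^sup>\<epsilon>\<^sup>i\<^sup>)\<close> for \<open>i\<close> in \<open>Y0 m\<close>.\<close>

definition gen :: "nat \<Rightarrow> nat \<Rightarrow> 'a::field lam"
  where "gen m i = (if i \<in> Y0 m then monomial (\<lambda>j. if j = i then 1 else 0, {})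
                    else monomial (\<lambda>_. 0, {i}))"

definition der_mon :: "nat \<Rightarrow> nat \<Rightarrow> mon \<Rightarrow> 'a::field lam"
  where "der_mon m i = (\<lambda>(\<alpha>, u).
    if i \<in> Y0 m then (if \<alpha> i = 0 then 0 else monomial (\<alpha>(i := \<alpha> i - 1), u))
    else (if i \<in> u then lscale ((- 1) ^ card {j \<in> u. j < i}) (monomial (\<alpha>, u - {i})) else 0))"

definition der :: "nat \<Rightarrow> nat \<Rightarrow> (nat \<Rightarrow> nat) \<Rightarrow> nat \<Rightarrow> 'a::field lam \<Rightarrow> 'a lam"
  where "der m n t i f = (\<Sum>b\<in>mbasis CHAR('a) m n t. lscale (f b) (der_mon m i b))"


subsection \<open>The Lie superalgebras \<open>W(m,n;t)\<close> and \<open>S(m,n;t)\<close>\<close>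

text \<open>
  \<open>\<Sum>\<^sub>i f\<^sub>i D\<^sub>i\<close> is encoded by its coefficients \<open>i \<mapsto> f\<^sub>i\<close>, zero for \<open>i\<close> outside \<open>Y m n\<close>; this is
  faithful because the \<open>D\<^sub>i\<close> are a basis of \<open>W(m,n;t)\<close> over \<open>\<Lambda>(m,n;t)\<close>.  \<open>fD f i\<close> is \<open>f D\<^sub>i\<close>.
\<close>

type_synonym 'a vf = "nat \<Rightarrow> 'a lam"

definition wscale :: "'a::field \<Rightarrow> 'a vf \<Rightarrow> 'a vf"
  where "wscale c X = (\<lambda>i. lscale c (X i))"

interpretation W: vector_space "wscale :: 'a::field \<Rightarrow> 'a vf \<Rightarrow> 'a vf"
  by standard (simp_all add: wscale_def lscale_def fun_eq_iff algebra_simps)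

definition fD :: "'a::field lam \<Rightarrow> nat \<Rightarrow> 'a vf"
  where "fD f i = (\<lambda>j. if j = i then f else 0)"

definition W_hom :: "nat \<Rightarrow> nat \<Rightarrow> (nat \<Rightarrow> nat) \<Rightarrow> bit \<Rightarrow> 'a::field vf set"
  where "W_hom m n t e =
    {X. (\<forall>i\<in>Y m n. X i \<in> Lam_hom m n t (e + tau m i)) \<and> (\<forall>i. i \<notin> Y m n \<longrightarrow> X i = 0)}"

text \<open>
  The bilinear extension of
  \<open>[f D\<^sub>i, g D\<^sub>j] = f D\<^sub>i(g) D\<^sub>j - (-1)\<^bsup>d(f D\<^sub>i) d(g D\<^sub>j)\<^esup> g D\<^sub>j(f) D\<^sub>i\<close>
  from homogeneous \<open>f\<close>, \<open>g\<close>: the indices \<open>a\<close>, \<open>b\<close> run over the parities of the coefficients.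
\<close>

definition bracket :: "nat \<Rightarrow> nat \<Rightarrow> (nat \<Rightarrow> nat) \<Rightarrow> 'a::field vf \<Rightarrow> 'a vf \<Rightarrow> 'a vf"
  where "bracket m n t X Z =
    (\<Sum>i\<in>Y m n. \<Sum>j\<in>Y m n. \<Sum>a\<in>{0, 1}. \<Sum>b\<in>{0, 1}.
       let f = hpart a (X i); g = hpart b (Z j) in
         fD (lmul m n t f (der m n t i g)) j
         - wscale (ksign ((a + tau m i) * (b + tau m j))) (fD (lmul m n t g (der m n t j f)) i))"

text \<open>\<open>D\<^sub>i\<^sub>j(f)\<close>, extended linearly from homogeneous \<open>f\<close>.\<close>

definition Dij :: "nat \<Rightarrow> nat \<Rightarrow> (nat \<Rightarrow> nat) \<Rightarrow> nat \<Rightarrow> nat \<Rightarrow> 'a::field lam \<Rightarrow> 'a vf"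
  where "Dij m n t i j f =
    (\<Sum>a\<in>{0, 1}.
       - wscale (ksign (a * (tau m i + tau m j))) (fD (der m n t j (hpart a f)) i)
       + wscale (ksign (tau m i * tau m j)) (fD (der m n t i (hpart a f)) j))"

definition S_alg :: "nat \<Rightarrow> nat \<Rightarrow> (nat \<Rightarrow> nat) \<Rightarrow> 'a::field vf set"
  where "S_alg m n t = W.span {Dij m n t i j f | i j f. i \<in> Y m n \<and> j \<in> Y m n \<and> f \<in> Lam m n t}"

definition S_hom :: "nat \<Rightarrow> nat \<Rightarrow> (nat \<Rightarrow> nat) \<Rightarrow> bit \<Rightarrow> 'a::field vf set"
  where "S_hom m n t e = S_alg m n t \<inter> W_hom m n t e"

end

theory Submission
  imports Defs
begin

text \<open>
  Put \<open>h = x\<^sub>k D\<^sub>k + x\<^sub>l D\<^sub>l\<close>; the two arguments of \<open>\<phi>\<close> in the claim are \<open>h\<close> and \<open>- D\<^sub>k\<close>, so it suffices that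
  \<open>v = \<phi>(h, D\<^sub>k)\<close> is a multiple of \<open>D\<^sub>k\<close>.  The operator \<open>ad h\<close> is diagonal on monomials, and since
  \<open>\<phi>(h, h) = 0\<close> the element \<open>v\<close> has \<open>h\<close>-weight \<open>-1\<close>.  For each \<open>s\<close> let \<open>z = \<phi>(D\<^sub>k, D\<^sub>s)\<close> and
  \<open>q = \<plusminus>[D\<^sub>s, v]\<close>.  Expanding \<open>\<phi>(D\<^sub>k, [D\<^sub>s, h])\<close>, \<open>\<phi>(D\<^sub>s, [D\<^sub>k, h])\<close> and \<open>\<phi>(h, [D\<^sub>k, D\<^sub>s]) = 0\<close> gives
  \<open>\<beta> z = -[h, z] - q\<close> and \<open>z = -[h, z] + q\<close>, where \<open>[D\<^sub>s, h] = \<beta> D\<^sub>s\<close>, \<open>\<beta> \<in> {0, 1}\<close>.  As \<open>q\<close> has weight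
  \<open>-1 - \<beta>\<close>, this forces \<open>q = 0\<close>.  So \<open>v\<close> has constant coefficients, and by its weight it is a
  combination of \<open>D\<^sub>k\<close> and \<open>D\<^sub>l\<close>.  Finally, for \<open>h' = x\<^sub>k\<^sub>' D\<^sub>k\<^sub>' + x\<^sub>l D\<^sub>l\<close> with \<open>k' \<noteq> k\<close>, the element \<open>\<phi>(h, h')\<close>
  has \<open>h'\<close>-weight \<open>0\<close>, and expanding \<open>\<phi>(h, [h', D\<^sub>k]) = 0\<close> removes the \<open>D\<^sub>l\<close>-coefficient.
\<close>

text \<open>Keeps the simplifier from rewriting sums and products of parities to \<open>XOR\<close> and \<open>AND\<close>.\<close>

declare add_bit_eq_xor [simp del] mult_bit_eq_and [simp del]

section \<open>Coefficients of derivatives and products in the divided power superalgebra\<close>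

lemma sum_apply: "(\<Sum>a\<in>A. F a) x = (\<Sum>a\<in>A. F a x)"
  for F :: "'b \<Rightarrow> 'c \<Rightarrow> 'd::comm_monoid_add"
  by (induction A rule: infinite_finite_induct) auto

lemma finite_expo: "finite (expo p m t)"
proof -
  have "expo p m t \<subseteq> {f. \<forall>x. (x \<in> Y0 m \<longrightarrow> f x \<in> (\<Union>i\<in>Y0 m. {..p ^ t i - 1})) \<and> (x \<notin> Y0 m \<longrightarrow> f x = 0)}"
    unfolding expo_def by fastforce
  moreover have "finite \<dots>"
    by (rule finite_set_of_finite_funs) (auto simp: Y0_def)
  ultimately show ?thesis
    by (rule finite_subset)
qed

lemma finite_mbasis: "finite (mbasis p m n t)"
  by (simp add: mbasis_def finite_expo Y1_def)

lemma Lam_zero_outside: "f b = 0" if "f \<in> Lam m n t" "b \<notin> mbasis CHAR('a) m n t" for f :: "'a::field lam"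
  using that unfolding Lam_def by blast

lemma lam_eqI: "(\<And>\<alpha> u. f (\<alpha>, u) = g (\<alpha>, u)) \<Longrightarrow> f = g" for f g :: "'a lam"
  by (rule ext) auto

lemma zero_in_Lam [simp]: "0 \<in> Lam m n t"
  by (simp add: Lam_def)

text \<open>On divided powers the derivative lowers an exponent with coefficient 1, so each output
  coefficient comes from the single monomial one step higher. If that monomial leaves the box of
  exponents, both sides are 0.\<close>

lemma der_apply_even:
  fixes f :: "'a::field lam"
  assumes "f \<in> Lam m n t" "i \<in> Y0 m"
  shows "der m n t i f (\<alpha>, u) = f (\<alpha>(i := Suc (\<alpha> i)), u)"
proof -
  have "f b * der_mon m i b (\<alpha>, u) = (if b = (\<alpha>(i := Suc (\<alpha> i)), u) then f b else 0)" for b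
  proof -
    obtain \<beta> v where b: "b = (\<beta>, v)" by fastforce
    have "\<beta> i \<noteq> 0 \<and> \<alpha> = \<beta>(i := \<beta> i - 1) \<longleftrightarrow> \<beta> = \<alpha>(i := Suc (\<alpha> i))"
      by (auto simp: fun_eq_iff)
    then show ?thesis
      using assms(2) unfolding b by (auto simp: der_mon_def monomial_def)
  qed
  then show ?thesis
    using assms(1) finite_mbasis[of "CHAR('a)" m n t]
    by (auto simp: der_def sum_apply lscale_def Lam_zero_outside)
qed

text \<open>The only source is the monomial with \<open>i\<close> inserted; this leaves the entries
  below \<open>i\<close> unchanged, so the sign can be counted in \<open>u\<close>.\<close>

lemma der_apply_odd:
  fixes f :: "'a::field lam"
  assumes "f \<in> Lam m n t" "i \<notin> Y0 m"
  shows "der m n t i f (\<alpha>, u) = (if i \<in> u then 0 else (-1) ^ card {j \<in> u. j < i} * f (\<alpha>, insert i u))"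
proof -
  have "f b * der_mon m i b (\<alpha>, u) =
      (if b = (\<alpha>, insert i u) then if i \<in> u then 0 else (-1) ^ card {j \<in> u. j < i} * f b else 0)" for b
  proof -
    obtain \<beta> v where b: "b = (\<beta>, v)" by fastforce
    have "i \<in> v \<and> u = v - {i} \<longleftrightarrow> i \<notin> u \<and> v = insert i u"
      by auto
    moreover have "{j \<in> insert i u. j < i} = {j \<in> u. j < i}"
      by auto
    ultimately show ?thesis
      using assms(2) unfolding b by (auto simp: der_mon_def monomial_def lscale_def)
  qed
  then show ?thesis
    using assms(1) finite_mbasis[of "CHAR('a)" m n t]
    by (auto simp: der_def sum_apply lscale_def Lam_zero_outside)
qed

lemma der_in_Lam:
  fixes f :: "'a::field lam"
  assumes f: "f \<in> Lam m n t" and i: "i \<in> Y m n"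
  shows "der m n t i f \<in> Lam m n t"
  unfolding Lam_def
proof (clarify)
  fix \<alpha> u assume out: "(\<alpha>, u) \<notin> mbasis CHAR('a) m n t"
  show "der m n t i f (\<alpha>, u) = 0"
  proof (cases "i \<in> Y0 m")
    case True
    have "(\<alpha>(i := Suc (\<alpha> i)), u) \<notin> mbasis CHAR('a) m n t"
      using out True by (force simp: mbasis_def expo_def split: if_splits)
    then show ?thesis
      using f True by (simp add: der_apply_even Lam_zero_outside)
  next
    case False
    have "(\<alpha>, insert i u) \<notin> mbasis CHAR('a) m n t"
      using out by (auto simp: mbasis_def)
    then show ?thesis
      using f False by (simp add: der_apply_odd Lam_zero_outside)
  qed
qed

lemma der_zero [simp]: "der m n t i 0 = 0"
  by (simp add: der_def lscale_def fun_eq_iff sum_apply)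

lemma lmul_apply:
  "lmul m n t f g c = (\<Sum>a\<in>mbasis CHAR('a) m n t. \<Sum>b\<in>mbasis CHAR('a) m n t. f a * g b * mul_mon m t a b c)"
  for f :: "'a::field lam"
  by (simp add: lmul_def sum_apply lscale_def)

lemma lmul_zero [simp]: "lmul m n t 0 g = 0" "lmul m n t f 0 = 0"
  by (simp_all add: fun_eq_iff lmul_apply)

lemma lmul_monomial_left:
  fixes g :: "'a::field lam"
  assumes "a \<in> mbasis CHAR('a) m n t"
  shows "lmul m n t (monomial a) g c = (\<Sum>b\<in>mbasis CHAR('a) m n t. g b * mul_mon m t a b c)"
proof -
  have "(\<Sum>b\<in>mbasis CHAR('a) m n t. monomial a d * g b * mul_mon m t d b c) =
      (if d = a then \<Sum>b\<in>mbasis CHAR('a) m n t. g b * mul_mon m t a b c else 0)" for d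
    by (simp add: monomial_def)
  then show ?thesis
    using assms finite_mbasis[of "CHAR('a)" m n t] by (simp add: lmul_apply)
qed

lemma lmul_monomial_right:
  fixes g :: "'a::field lam"
  assumes "a \<in> mbasis CHAR('a) m n t"
  shows "lmul m n t g (monomial a) c = (\<Sum>b\<in>mbasis CHAR('a) m n t. g b * mul_mon m t b a c)"
proof -
  have "g b * monomial a d * mul_mon m t b d c = (if d = a then g b * mul_mon m t b a c else 0)" for b d
    by (simp add: monomial_def)
  then show ?thesis
    using assms finite_mbasis[of "CHAR('a)" m n t] by (simp add: lmul_apply)
qed

abbreviation lone :: "'a::field lam"
  where "lone \<equiv> monomial (\<lambda>_. 0, {})"

lemma one_mem_mbasis: "(\<lambda>_. 0, {}) \<in> mbasis p m n t"
  by (simp add: mbasis_def expo_def)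

lemma lmul_one:
  fixes g :: "'a::field lam"
  assumes "g \<in> Lam m n t"
  shows "lmul m n t lone g = g" "lmul m n t g lone = g"
proof -
  have "g b * mul_mon m t (\<lambda>_. 0, {}) b c = (if b = c then g b else 0)"
       "g b * mul_mon m t b (\<lambda>_. 0, {}) c = (if b = c then g b else 0)"
    if "b \<in> mbasis CHAR('a) m n t" for b c
    using that by (auto simp: mul_mon_def mbasis_def monomial_def lscale_def)
  then show "lmul m n t lone g = g" "lmul m n t g lone = g"
    using assms finite_mbasis[of "CHAR('a)" m n t]
    by (auto simp: fun_eq_iff lmul_monomial_left lmul_monomial_right one_mem_mbasis Lam_zero_outside)
qed

lemma lone_in_Lam: "lone \<in> Lam m n t"
  using one_mem_mbasis by (auto simp: Lam_def monomial_def)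

lemma monomial_apply: "monomial b c = (if c = b then 1 else 0)"
  by (simp add: monomial_def)

lemma der_lone [simp]:
  assumes "i \<in> Y m n"
  shows "der m n t i (lone :: 'a::field lam) = 0"
proof (rule lam_eqI)
  fix \<alpha> u
  have "\<alpha>(i := Suc (\<alpha> i)) \<noteq> (\<lambda>_. 0)"
    by (metis fun_upd_same nat.simps(3))
  then show "der m n t i (lone :: 'a lam) (\<alpha>, u) = 0 (\<alpha>, u)"
    by (cases "i \<in> Y0 m") (simp_all add: der_apply_even der_apply_odd lone_in_Lam monomial_apply)
qed

section \<open>The generators and their Euler operators\<close>

lemma gen_even: "k \<in> Y0 m \<Longrightarrow> gen m k = monomial (\<lambda>j. if j = k then 1 else 0, {})"
  by (simp add: gen_def)

lemma gen_odd: "l \<in> Y1 m n \<Longrightarrow> gen m l = monomial (\<lambda>_. 0, {l})"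
  by (auto simp: gen_def Y0_def Y1_def)

lemma Y_cases: "i \<in> Y m n \<Longrightarrow> i \<in> Y0 m \<or> i \<in> Y1 m n"
  by (simp add: Y_def)

lemma odd_not_even: "l \<in> Y1 m n \<Longrightarrow> l \<notin> Y0 m"
  by (auto simp: Y0_def Y1_def)

lemma tau_simps: "k \<in> Y0 m \<Longrightarrow> tau m k = 0" "l \<in> Y1 m n \<Longrightarrow> tau m l = 1"
  by (auto simp: tau_def Y0_def Y1_def)

lemma unit_in_expo:
  assumes "k \<in> Y0 m" "t k \<ge> 1" "p > 2"
  shows "(\<lambda>j. if j = k then 1 else 0) \<in> expo p m t"
proof -
  have "p ^ t k \<ge> p ^ 1"
    using assms by (intro power_increasing) auto
  then show ?thesis
    using assms by (auto simp: expo_def)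
qed

lemma gen_monomial:
  assumes "CHAR('a::field) > 2" "\<forall>i\<in>Y0 m. t i \<ge> 1" "i \<in> Y m n"
  obtains b where "b \<in> mbasis CHAR('a) m n t" "gen m i = (monomial b :: 'a lam)" "mpar b = tau m i"
  using Y_cases[OF assms(3)]
proof
  assume "i \<in> Y0 m"
  with assms show thesis
    by (intro that) (auto simp: gen_even mbasis_def mpar_def tau_simps unit_in_expo)
next
  assume "i \<in> Y1 m n"
  with assms show thesis
    by (intro that) (auto simp: gen_odd mbasis_def mpar_def tau_simps expo_def)
qed

lemma monomial_in_Lam_hom:
  "b \<in> mbasis CHAR('a) m n t \<Longrightarrow> (monomial b :: 'a::field lam) \<in> Lam_hom m n t (mpar b)"
  by (auto simp: Lam_hom_def Lam_def hpart_def monomial_def fun_eq_iff)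

lemma gen_in_Lam_hom:
  assumes "CHAR('a::field) > 2" "\<forall>i\<in>Y0 m. t i \<ge> 1" "i \<in> Y m n"
  shows "(gen m i :: 'a lam) \<in> Lam_hom m n t (tau m i)"
  by (rule gen_monomial[OF assms]) (metis monomial_in_Lam_hom)

lemma Lam_homD: "f \<in> Lam_hom m n t e \<Longrightarrow> f \<in> Lam m n t"
  by (simp add: Lam_hom_def)

lemma der_gen:
  assumes "CHAR('a::field) > 2" "\<forall>i\<in>Y0 m. t i \<ge> 1" "i \<in> Y m n" "j \<in> Y m n"
  shows "der m n t j (gen m i :: 'a lam) = (if i = j then lone else 0)"
proof -
  note L = Lam_homD[OF gen_in_Lam_hom[OF assms(1-3)]]
  have *: "\<alpha>(j := Suc (\<alpha> j)) = (\<lambda>r. if r = i then 1 else 0) \<longleftrightarrow> i = j \<and> \<alpha> = (\<lambda>_. 0)" for i \<alpha>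
    by (auto simp: fun_eq_iff)
  have **: "j \<notin> u \<Longrightarrow> insert j u = {i} \<longleftrightarrow> i = j \<and> u = {}" for u
    by auto
  have ***: "\<alpha>(j := Suc (\<alpha> j)) \<noteq> (\<lambda>_. 0)" for \<alpha>
    by (metis fun_upd_same nat.simps(3))
  show ?thesis
  proof (rule lam_eqI)
    fix \<alpha> u
    from Y_cases[OF assms(3)] Y_cases[OF assms(4)]
    show "der m n t j (gen m i :: 'a lam) (\<alpha>, u) = (if i = j then lone else 0) (\<alpha>, u)"
      by (elim disjE) (simp_all add: L der_apply_even der_apply_odd odd_not_even,
        auto simp: gen_even gen_odd monomial_apply odd_not_even * ** ***)
  qed
qed

text \<open>The derivative contributes no factor; multiplying the divided power of exponent
  \<open>\<alpha> k - 1\<close> by \<open>gen m k\<close> contributes the binomial coefficient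
  \<open>\<alpha> k\<close>.\<close>

lemma euler_even:
  fixes f :: "'a::field lam"
  assumes "CHAR('a) > 2" "\<forall>i\<in>Y0 m. t i \<ge> 1" and k: "k \<in> Y0 m" and f: "f \<in> Lam m n t"
  shows "lmul m n t (gen m k) (der m n t k f) (\<alpha>, u) = of_nat (\<alpha> k) * f (\<alpha>, u)"
proof -
  let ?e = "\<lambda>j. if j = k then 1 else 0 :: nat"
  let ?M = "mbasis CHAR('a) m n t"
  let ?g = "der m n t k f"
  have e: "(?e, {}) \<in> ?M"
    using assms by (simp add: mbasis_def unit_in_expo)
  have "?g b * mul_mon m t (?e, {}) b (\<alpha>, u) =
      (if b = (\<alpha>(k := \<alpha> k - 1), u) then of_nat (\<alpha> k) * f (\<alpha>, u) else 0)" if b: "b \<in> ?M" for b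
  proof -
    obtain \<beta> v where bv: "b = (\<beta>, v)" by fastforce
    have fin: "finite (Y0 m)" by (simp add: Y0_def)
    have prod: "(\<Prod>i\<in>Y0 m. ?e i + \<beta> i choose ?e i) = \<beta> k + 1"
    proof -
      have "(\<Prod>i\<in>Y0 m. ?e i + \<beta> i choose ?e i) = (\<Prod>i\<in>Y0 m. if i = k then \<beta> i + 1 else 1)"
        by (rule prod.cong) auto
      then show ?thesis using fin k by simp
    qed
    have sums: "(\<lambda>i. ?e i + \<beta> i) = \<beta>(k := Suc (\<beta> k))" by auto
    have mm: "mul_mon m t (?e, {}) b (\<alpha>, u) =
        (if \<beta>(k := Suc (\<beta> k)) = \<alpha> \<and> v = u \<and> \<alpha> \<in> expo CHAR('a) m t then of_nat (\<beta> k + 1) else (0::'a))"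
      unfolding bv mul_mon_def prod.case prod sums by (auto simp: lscale_def monomial_apply)
    show ?thesis
    proof (cases "b = (\<alpha>(k := \<alpha> k - 1), u)")
      case True
      then have bv': "\<beta> = \<alpha>(k := \<alpha> k - 1)" "v = u" using bv by auto
      \<comment> \<open>The product is truncated outside the box of exponents, and \<open>f\<close>
        has no coefficients there either.\<close>
      have out: "f (\<alpha>, u) = 0" if "\<alpha> \<notin> expo CHAR('a) m t"
        using f that by (auto intro!: Lam_zero_outside simp: mbasis_def)
      show ?thesis
      proof (cases "\<alpha> k = 0")
        \<comment> \<open>Truncated subtraction makes \<open>\<beta>\<close> equal to
          \<open>\<alpha>\<close> here, and raising its exponent misses \<open>\<alpha>\<close>;
          this agrees with the factor 0.\<close>
        case True
        then have "\<beta>(k := Suc (\<beta> k)) \<noteq> \<alpha>" by (metis fun_upd_same nat.simps(3))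
        with True show ?thesis by (simp add: mm)
      next
        case False
        then have \<alpha>: "\<beta>(k := Suc (\<beta> k)) = \<alpha>" "\<beta> k + 1 = \<alpha> k" by (auto simp: bv')
        have "?g b = f (\<beta>(k := Suc (\<beta> k)), u)"
          unfolding bv bv' by (rule der_apply_even[OF f k])
        then show ?thesis
          using bv'(2) out unfolding mm if_P[OF True] \<alpha> by auto
      qed
    next
      case False
      then have "\<not> (\<beta>(k := Suc (\<beta> k)) = \<alpha> \<and> v = u)" using bv by auto
      with False show ?thesis by (auto simp: mm)
    qed
  qed
  then have "lmul m n t (gen m k) ?g (\<alpha>, u) =
      (if (\<alpha>(k := \<alpha> k - 1), u) \<in> ?M then of_nat (\<alpha> k) * f (\<alpha>, u) else 0)"
    using k e finite_mbasis[of "CHAR('a)" m n t] by (simp add: gen_even lmul_monomial_left)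
  moreover have "f (\<alpha>, u) = 0 \<or> (\<alpha>, u) \<in> ?M"
    using f by (auto intro: Lam_zero_outside)
  then have "f (\<alpha>, u) = 0 \<or> (\<alpha>(k := \<alpha> k - 1), u) \<in> ?M"
    by (auto simp: mbasis_def expo_def diff_le_mono le_diff_conv trans_le_add1 split: if_splits)
  ultimately show ?thesis by auto
qed

text \<open>Extracting the odd variable and multiplying it back from the left cost the same sign, so
  the signs cancel.\<close>

lemma euler_odd:
  fixes f :: "'a::field lam"
  assumes l: "l \<in> Y1 m n" and f: "f \<in> Lam m n t"
  shows "lmul m n t (gen m l) (der m n t l f) (\<alpha>, u) = (if l \<in> u then f (\<alpha>, u) else 0)"
proof -
  let ?M = "mbasis CHAR('a) m n t"
  let ?g = "der m n t l f"
  have e: "(\<lambda>_. 0, {l}) \<in> ?M"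
    using l by (simp add: mbasis_def expo_def)
  have "?g b * mul_mon m t (\<lambda>_. 0, {l}) b (\<alpha>, u) =
      (if b = (\<alpha>, u - {l}) then if l \<in> u then f (\<alpha>, u) else 0 else 0)" if b: "b \<in> ?M" for b
  proof -
    obtain \<beta> v where bv: "b = (\<beta>, v)" by fastforce
    \<comment> \<open>The inversions created by putting \<open>l\<close> in front of
      \<open>v\<close> correspond to the entries of \<open>v\<close> below \<open>l\<close>, which
      also give the sign of the derivative.\<close>
    have "{(i, j). i \<in> {l} \<and> j \<in> v \<and> j < i} = Pair l ` {j \<in> v. j < l}" by auto
    then have c: "card {(i, j). i \<in> {l} \<and> j \<in> v \<and> j < i} = card {j \<in> v. j < l}"
      by (simp add: card_image inj_on_def)
    have *: "l \<notin> v \<and> u = insert l v \<longleftrightarrow> l \<in> u \<and> v = u - {l}" by auto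
    have sgn: "(-1) ^ r * ((-1) ^ r * x) = x" for r and x :: 'a
      by (simp flip: mult.assoc power_mult_distrib)
    show ?thesis
      using b l unfolding bv mul_mon_def prod.case c
      by (auto simp: lscale_def monomial_def mbasis_def der_apply_odd f odd_not_even * insert_absorb sgn mult_ac)
  qed
  then have "lmul m n t (gen m l) ?g (\<alpha>, u) =
      (if (\<alpha>, u - {l}) \<in> ?M then if l \<in> u then f (\<alpha>, u) else 0 else 0)"
    using l e finite_mbasis[of "CHAR('a)" m n t] by (simp add: gen_odd lmul_monomial_left)
  moreover have "f (\<alpha>, u) = 0 \<or> (\<alpha>, u) \<in> ?M"
    using f by (auto intro: Lam_zero_outside)
  then have "f (\<alpha>, u) = 0 \<or> (\<alpha>, u - {l}) \<in> ?M"
    by (auto simp: mbasis_def)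
  ultimately show ?thesis by auto
qed

lemma lmul_gen_gen:
  assumes "CHAR('a::field) > 2" "\<forall>i\<in>Y0 m. t i \<ge> 1" "k \<in> Y0 m" "l \<in> Y1 m n"
  shows "lmul m n t (gen m k) (gen m l :: 'a lam) = monomial (\<lambda>j. if j = k then 1 else 0, {l})"
proof -
  let ?e = "\<lambda>j. if j = k then 1 else 0 :: nat"
  let ?M = "mbasis CHAR('a) m n t"
  have ex: "?e \<in> expo CHAR('a) m t" using assms unit_in_expo by blast
  have mem: "(?e, {}) \<in> ?M" "(\<lambda>_. 0, {l}) \<in> ?M"
    using assms(4) ex by (simp_all add: mbasis_def, simp add: expo_def)
  have "(\<Prod>i\<in>Y0 m. ?e i choose ?e i) = 1" by simp
  then have "mul_mon m t (?e, {}) (\<lambda>_. 0, {l}) = (monomial (?e, {l}) :: 'a lam)"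
    using ex by (auto simp: mul_mon_def lscale_def)
  moreover have "monomial (\<lambda>_. 0, {l}) b * mul_mon m t (?e, {}) b c =
      (if b = (\<lambda>_. 0, {l}) then mul_mon m t (?e, {}) (\<lambda>_. 0, {l}) c else (0::'a))" for b c
    by (simp add: monomial_def)
  ultimately show ?thesis
    using mem assms finite_mbasis[of "CHAR('a)" m n t]
    by (simp add: fun_eq_iff gen_even gen_odd lmul_monomial_left)
qed

subsection \<open>The bracket of homogeneous elements\<close>

lemma finite_Y: "finite (Y m n)"
  by (simp add: Y_def Y0_def Y1_def)

lemma bit_cases: "(a::bit) = 0 \<or> a = 1"
  by (cases a) auto

lemma hpart_hom:
  assumes "f \<in> Lam_hom m n t e"
  shows "hpart a f = (if a = e then f else 0)"
proof -
  have "hpart e f = f" using assms by (simp add: Lam_hom_def)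
  then have "f b = 0" if "mpar b \<noteq> e" for b
    using that by (metis hpart_def)
  then show ?thesis by (auto simp: hpart_def fun_eq_iff)
qed

lemma W_hom_Lam: "X \<in> W_hom m n t e \<Longrightarrow> X i \<in> Lam m n t"
  by (cases "i \<in> Y m n") (auto simp: W_hom_def Lam_hom_def)

lemma lscale_zero [simp]: "lscale c 0 = 0"
  by (simp add: lscale_def fun_eq_iff)

lemma lscale_sum: "lscale c (\<Sum>i\<in>A. F i) = (\<Sum>i\<in>A. lscale c (F i))"
  by (simp add: lscale_def fun_eq_iff sum_apply sum_distrib_left)

lemma wscale_fD: "wscale c (fD f i) r = (if r = i then lscale c f else 0)"
  by (simp add: wscale_def fD_def)

text \<open>Homogeneity leaves only the parities \<open>a = d + tau m i\<close> and
  \<open>b = e + tau m j\<close>, so the sign exponent is \<open>d * e\<close> for all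
  \<open>i\<close> and \<open>j\<close> and can be pulled out of the sums.\<close>

lemma bracket_hom:
  fixes X Z :: "'a::field vf"
  assumes X: "X \<in> W_hom m n t d" and Z: "Z \<in> W_hom m n t e"
  shows "bracket m n t X Z r = (if r \<in> Y m n
    then (\<Sum>i\<in>Y m n. lmul m n t (X i) (der m n t i (Z r)))
         - lscale (ksign (d * e)) (\<Sum>j\<in>Y m n. lmul m n t (Z j) (der m n t j (X r)))
    else 0)"
proof -
  let ?T = "\<lambda>i j. fD (lmul m n t (X i) (der m n t i (Z j))) j
         - wscale (ksign (d * e)) (fD (lmul m n t (Z j) (der m n t j (X i))) i)"
  have inner: "(\<Sum>a\<in>{0, 1}. \<Sum>b\<in>{0, 1}.
       let f = hpart a (X i); g = hpart b (Z j) in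
         fD (lmul m n t f (der m n t i g)) j
         - wscale (ksign ((a + tau m i) * (b + tau m j))) (fD (lmul m n t g (der m n t j f)) i)) = ?T i j"
    if "i \<in> Y m n" "j \<in> Y m n" for i j
  proof -
    have Xi: "hpart a (X i) = (if a = d + tau m i then X i else 0)" for a
      using X that by (intro hpart_hom) (auto simp: W_hom_def)
    have Zj: "hpart b (Z j) = (if b = e + tau m j then Z j else 0)" for b
      using Z that by (intro hpart_hom) (auto simp: W_hom_def)
    have fD0: "fD 0 i = 0" for i by (auto simp: fD_def fun_eq_iff)
    have ws0: "wscale c 0 = 0" for c :: 'a by (simp add: wscale_def lscale_def fun_eq_iff)
    show ?thesis
      unfolding Let_def Xi Zj
      using bit_cases[of d] bit_cases[of e] bit_cases[of "tau m i"] bit_cases[of "tau m j"]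
      by (auto simp: fD0 ws0)
  qed
  have "bracket m n t X Z = (\<Sum>i\<in>Y m n. \<Sum>j\<in>Y m n. ?T i j)"
    unfolding bracket_def by (intro sum.cong refl inner)
  then have "bracket m n t X Z r = (\<Sum>i\<in>Y m n. \<Sum>j\<in>Y m n. ?T i j r)"
    by (simp only: sum_apply)
  also have "\<dots> = (\<Sum>i\<in>Y m n. \<Sum>j\<in>Y m n. fD (lmul m n t (X i) (der m n t i (Z j))) j r)
      - (\<Sum>i\<in>Y m n. \<Sum>j\<in>Y m n. wscale (ksign (d * e)) (fD (lmul m n t (Z j) (der m n t j (X i))) i) r)"
    by (simp add: sum_subtractf)
  also have "(\<Sum>i\<in>Y m n. \<Sum>j\<in>Y m n. fD (lmul m n t (X i) (der m n t i (Z j))) j r) =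
      (if r \<in> Y m n then \<Sum>i\<in>Y m n. lmul m n t (X i) (der m n t i (Z r)) else 0)"
    using finite_Y by (simp add: fD_def)
  \<comment> \<open>These terms sit at index \<open>i\<close>, so the sums are swapped before the
    inner one collapses to \<open>i = r\<close>.\<close>
  also have "(\<Sum>i\<in>Y m n. \<Sum>j\<in>Y m n. wscale (ksign (d * e)) (fD (lmul m n t (Z j) (der m n t j (X i))) i) r) =
      (\<Sum>j\<in>Y m n. \<Sum>i\<in>Y m n. if r = i then lscale (ksign (d * e)) (lmul m n t (Z j) (der m n t j (X i))) else 0)"
    by (subst sum.swap) (simp only: wscale_fD)
  also have "\<dots> = (if r \<in> Y m n then lscale (ksign (d * e)) (\<Sum>j\<in>Y m n. lmul m n t (Z j) (der m n t j (X r))) else 0)"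
    by (cases "r \<in> Y m n")
      (simp_all only: sum.delta'[OF finite_Y] if_True if_False sum.neutral_const lscale_sum)
  finally show ?thesis by auto
qed

lemma lscale_in_Lam_hom: "f \<in> Lam_hom m n t e \<Longrightarrow> lscale c f \<in> Lam_hom m n t e"
proof -
  have "hpart e (lscale c f) = lscale c (hpart e f)"
    by (simp add: hpart_def lscale_def fun_eq_iff)
  then show "f \<in> Lam_hom m n t e \<Longrightarrow> lscale c f \<in> Lam_hom m n t e"
    by (simp add: Lam_hom_def Lam_def) (simp add: lscale_def)
qed

lemma wscale_in_W_hom: "X \<in> W_hom m n t e \<Longrightarrow> wscale c X \<in> W_hom m n t e"
  by (simp add: W_hom_def wscale_def lscale_in_Lam_hom)

lemma ksign_square: "ksign a * ksign a = (1 :: 'a::field)"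
  by (simp add: ksign_def)

text \<open>Exchanging the arguments exchanges the two sums of \<open>bracket_hom\<close>; the sign
  is its own inverse and therefore factors out.\<close>

lemma bracket_skew:
  fixes X Z :: "'a::field vf"
  assumes "X \<in> W_hom m n t d" "Z \<in> W_hom m n t e"
  shows "bracket m n t X Z = - wscale (ksign (d * e)) (bracket m n t Z X)"
proof -
  define c :: 'a where "c = ksign (d * e)"
  have c: "ksign (e * d) = c" "c * c = 1"
    by (simp_all only: c_def ksign_square mult.commute)
  have sgn: "a - c * b = - (c * (b - c * a))" for a b
    using c(2) by (simp add: right_diff_distrib flip: mult.assoc)
  have "bracket m n t X Z r b = - (c * bracket m n t Z X r b)" for r b
    unfolding bracket_hom[OF assms] bracket_hom[OF assms(2,1)] c(1) c_def[symmetric]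
    by (cases "r \<in> Y m n") (simp_all only: if_True if_False lscale_def minus_apply zero_fun_apply
        mult_zero_right minus_zero sgn[symmetric])
  then show ?thesis
    unfolding c_def[symmetric] by (simp add: fun_eq_iff wscale_def lscale_def)
qed

lemma zero_in_Lam_hom [simp]: "0 \<in> Lam_hom m n t e"
  by (simp add: Lam_hom_def hpart_def fun_eq_iff)

lemma zero_in_W_hom: "0 \<in> W_hom m n t e"
  by (simp add: W_hom_def)

lemma bracket_zero:
  assumes "X \<in> W_hom m n t d"
  shows "bracket m n t 0 X = 0"
  by (rule ext) (simp add: bracket_hom[OF zero_in_W_hom[where e=0] assms])

abbreviation partial :: "nat \<Rightarrow> 'a::field vf"
  where "partial s \<equiv> fD lone s"

lemma lone_in_Lam_hom: "lone \<in> Lam_hom m n t 0"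
  using monomial_in_Lam_hom[OF one_mem_mbasis] by (simp add: mpar_def)

lemma partial_in_W_hom: "s \<in> Y m n \<Longrightarrow> (partial s :: 'a::field vf) \<in> W_hom m n t (tau m s)"
  using lone_in_Lam_hom by (auto simp: W_hom_def fD_def)

text \<open>The coefficients of \<open>partial s\<close> are constant, so \<open>X\<close> kills
  them and only the coefficientwise derivative of \<open>X\<close> remains.\<close>

lemma bracket_partial:
  fixes X :: "'a::field vf"
  assumes "s \<in> Y m n" "X \<in> W_hom m n t e"
  shows "bracket m n t (partial s) X r = (if r \<in> Y m n then der m n t s (X r) else 0)"
proof -
  have "lmul m n t (partial s i) (der m n t i (X r)) = (if i = s then der m n t s (X r) else 0)" for i
    using assms W_hom_Lam[OF assms(2)] by (simp add: fD_def lmul_one der_in_Lam)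
  then have 1: "(\<Sum>i\<in>Y m n. lmul m n t (partial s i) (der m n t i (X r))) = der m n t s (X r)"
    using assms(1) finite_Y by simp
  have 2: "(\<Sum>j\<in>Y m n. lmul m n t (X j) (der m n t j (partial s r))) = 0"
    by (rule sum.neutral) (simp add: fD_def)
  show ?thesis
    unfolding bracket_hom[OF partial_in_W_hom[OF assms(1)] assms(2)] 1 2 by simp
qed

subsection \<open>Torus elements\<close>

abbreviation torus :: "nat \<Rightarrow> nat \<Rightarrow> nat \<Rightarrow> 'a::field vf"
  where "torus m k l \<equiv> fD (gen m k) k + fD (gen m l) l"

text \<open>The eigenvalue of the adjoint action of \<open>x\<^sub>k D\<^sub>k + x\<^sub>l D\<^sub>l\<close> on \<open>x\<^sup>(\<^sup>\<alpha>\<^sup>) x\<^sup>u D\<^sub>r\<close>.\<close>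

definition weight :: "nat \<Rightarrow> nat \<Rightarrow> nat \<Rightarrow> mon \<Rightarrow> 'a::field"
  where "weight k l r b = of_nat (fst b k) + of_bool (l \<in> snd b) - of_bool (r = k) - of_bool (r = l)"

lemma torus_in_W_hom:
  assumes "CHAR('a::field) > 2" "\<forall>i\<in>Y0 m. t i \<ge> 1" "k \<in> Y0 m" "l \<in> Y1 m n"
  shows "(torus m k l :: 'a vf) \<in> W_hom m n t 0"
proof -
  have "k \<in> Y m n" "l \<in> Y m n" "k \<noteq> l" using assms odd_not_even by (auto simp: Y_def)
  moreover from this have "(gen m k :: 'a lam) \<in> Lam_hom m n t (tau m k)" "(gen m l :: 'a lam) \<in> Lam_hom m n t (tau m l)"
    using gen_in_Lam_hom[OF assms(1,2)] by blast+
  ultimately show ?thesis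
    unfolding W_hom_def fD_def plus_fun_apply add_0 by force
qed

text \<open>The Euler operators supply the first two terms of the weight. In the other half of the
  bracket, \<open>X\<close> acts on the linear coefficients of the torus element and returns
  \<open>X r\<close> exactly for \<open>r = k\<close> or \<open>r = l\<close>.\<close>

lemma bracket_torus:
  fixes X :: "'a::field vf"
  assumes "CHAR('a) > 2" "\<forall>i\<in>Y0 m. t i \<ge> 1" "k \<in> Y0 m" "l \<in> Y1 m n" and X: "X \<in> W_hom m n t e"
  shows "bracket m n t (torus m k l) X r b = weight k l r b * X r b"
proof (cases "r \<in> Y m n")
  case False
  then show ?thesis
    using X by (simp add: bracket_hom[OF torus_in_W_hom[OF assms(1-4)] X] W_hom_def)
next
  case True
  have Y: "k \<in> Y m n" "l \<in> Y m n" "k \<noteq> l" using assms odd_not_even by (auto simp: Y_def)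
  obtain \<alpha> u where b: "b = (\<alpha>, u)" by fastforce
  note L = W_hom_Lam[OF X]
  define h :: "'a vf" where "h = torus m k l"
  have hW: "h \<in> W_hom m n t 0"
    unfolding h_def by (rule torus_in_W_hom[OF assms(1-4)])
  have h: "h i = (if i = k then gen m k else if i = l then gen m l else 0)" for i
    using Y by (simp add: h_def fD_def)
  have "lmul m n t (h i) (der m n t i (X r)) =
      (if i = k then lmul m n t (gen m k) (der m n t k (X r)) else 0)
      + (if i = l then lmul m n t (gen m l) (der m n t l (X r)) else 0)" for i
    using Y by (simp add: h)
  then have 1: "(\<Sum>i\<in>Y m n. lmul m n t (h i) (der m n t i (X r))) =
      lmul m n t (gen m k) (der m n t k (X r)) + lmul m n t (gen m l) (der m n t l (X r))"
    using Y finite_Y by (simp add: sum.distrib)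
  have "lmul m n t (X j) (der m n t j (h r)) =
      (if j = r then if r = k \<or> r = l then X r else 0 else 0)" if "j \<in> Y m n" for j
    using that Y L by (simp add: h der_gen[OF assms(1,2)] lmul_one)
  then have 2: "(\<Sum>j\<in>Y m n. lmul m n t (X j) (der m n t j (h r))) = (if r = k \<or> r = l then X r else 0)"
    using True finite_Y by simp
  have "bracket m n t h X r b = of_nat (\<alpha> k) * X r b + of_bool (l \<in> u) * X r b - of_bool (r = k \<or> r = l) * X r b"
    unfolding bracket_hom[OF hW X] 1 2 b
    by (simp add: True lscale_def ksign_def euler_even[OF assms(1-3) L] euler_odd[OF assms(4) L])
  also have "of_bool (r = k \<or> r = l) = (of_bool (r = k) + of_bool (r = l) :: 'a)"
    using Y(3) by auto
  finally show ?thesis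
    by (simp add: h_def weight_def b algebra_simps del: plus_fun_apply)
qed

lemma bracket_torus_partial:
  assumes "CHAR('a::field) > 2" "\<forall>i\<in>Y0 m. t i \<ge> 1" "k \<in> Y0 m" "l \<in> Y1 m n" "s \<in> Y m n"
  shows "bracket m n t (torus m k l) (partial s) =
    wscale (- (of_bool (s = k) + of_bool (s = l)) :: 'a) (partial s)"
  by (rule ext, rule ext, unfold bracket_torus[OF assms(1-4) partial_in_W_hom[OF assms(5)]])
    (auto simp: weight_def wscale_def lscale_def fD_def monomial_apply)

text \<open>Both monomials of \<open>torus m k l\<close> have weight 0 with respect to
  \<open>torus m k' l\<close>.\<close>

lemma bracket_torus_torus:
  assumes "CHAR('a::field) > 2" "\<forall>i\<in>Y0 m. t i \<ge> 1" "k \<in> Y0 m" "k' \<in> Y0 m" "k' \<noteq> k" "l \<in> Y1 m n"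
  shows "bracket m n t (torus m k' l) (torus m k l) = (0 :: 'a vf)"
proof (rule ext, rule ext)
  fix r b
  have "l \<noteq> k" "l \<noteq> k'" using assms odd_not_even by blast+
  then have "weight k' l r b * (torus m k l :: 'a vf) r b = 0"
    using assms by (auto simp: weight_def fD_def monomial_apply gen_even gen_odd)
  then show "bracket m n t (torus m k' l) (torus m k l) r b = (0 :: 'a vf) r b"
    by (simp only: bracket_torus[OF assms(1,2,4,6) torus_in_W_hom[OF assms(1,2,3,6)]] zero_fun_apply)
qed

lemma bracket_partial_partial:
  assumes "k \<in> Y m n" "s \<in> Y m n"
  shows "bracket m n t (partial k) (partial s) = (0 :: 'a::field vf)"
  by (rule ext, unfold bracket_partial[OF assms(1) partial_in_W_hom[OF assms(2)]])
    (simp add: fD_def assms(1))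

text \<open>A coefficient of a derivative is read off one step higher; this and the next lemma
  record the resulting shift of the weight.\<close>

lemma weight_der_even:
  "weight k l r (\<alpha>(s := Suc (\<alpha> s)), u) = weight k l r (\<alpha>, u) + (of_bool (s = k) :: 'a::field)"
  by (simp add: weight_def)

lemma weight_der_odd:
  "s \<notin> u \<Longrightarrow> weight k l r (\<alpha>, insert s u) = weight k l r (\<alpha>, u) + (of_bool (s = l) :: 'a::field)"
  by (auto simp: weight_def)

text \<open>Any exponent or odd factor in \<open>b\<close> could be lowered by its derivative, which
  would then have the coefficient \<open>f b\<close> up to sign.\<close>

lemma const_if_der_zero:
  fixes f :: "'a::field lam"
  assumes f: "f \<in> Lam m n t" and der: "\<And>s. s \<in> Y m n \<Longrightarrow> der m n t s f = 0" and b: "f b \<noteq> 0"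
  shows "b = (\<lambda>_. 0, {})"
proof -
  obtain \<alpha> u where b_eq: "b = (\<alpha>, u)" by fastforce
  have mem: "(\<alpha>, u) \<in> mbasis CHAR('a) m n t"
    using f b Lam_zero_outside b_eq by blast
  have "\<alpha> i = 0" for i
  proof (rule ccontr)
    assume i: "\<alpha> i \<noteq> 0"
    then have "i \<in> Y0 m" using mem by (auto simp: mbasis_def expo_def)
    with i have "der m n t i f (\<alpha>(i := \<alpha> i - 1), u) = f (\<alpha>, u)"
      by (simp add: der_apply_even[OF f])
    with der[of i] \<open>i \<in> Y0 m\<close> b show False by (simp add: b_eq Y_def)
  qed
  moreover have "u = {}"
  proof (rule ccontr)
    assume "u \<noteq> {}"
    then obtain j where j: "j \<in> u" by blast
    then have "j \<in> Y1 m n" using mem by (auto simp: mbasis_def)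
    then have "der m n t j f (\<alpha>, u - {j}) = (-1) ^ card {i \<in> u - {j}. i < j} * f (\<alpha>, u)"
      using j by (simp add: der_apply_odd[OF f] odd_not_even insert_absorb)
    with der[of j] \<open>j \<in> Y1 m n\<close> b show False by (simp add: b_eq Y_def)
  qed
  ultimately show ?thesis by (simp add: b_eq fun_eq_iff)
qed

subsection \<open>Elements of \<open>S(m,n;t)\<close>\<close>

lemma der_uminus: "der m n t i (- f) = - der m n t i (f :: 'a::field lam)"
  by (simp add: der_def lscale_def fun_eq_iff sum_apply sum_negf)

lemma der_lscale: "der m n t i (lscale c f) = lscale c (der m n t i (f :: 'a::field lam))"
  by (simp add: der_def lscale_def fun_eq_iff sum_apply sum_distrib_left mult.assoc)

lemma Dij_hom:
  assumes "f \<in> Lam_hom m n t a"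
  shows "Dij m n t i j f = - wscale (ksign (a * (tau m i + tau m j))) (fD (der m n t j f) i)
    + wscale (ksign (tau m i * tau m j)) (fD (der m n t i f) j)"
proof -
  have [simp]: "fD 0 i = 0" "wscale c 0 = 0" for i and c :: 'a
    by (simp_all add: fD_def wscale_def fun_eq_iff)
  show ?thesis
    unfolding Dij_def hpart_hom[OF assms] using bit_cases[of a] by (elim disjE) simp_all
qed

lemma Dij_gen_even:
  assumes "CHAR('a::field) > 2" "\<forall>i\<in>Y0 m. t i \<ge> 1" "k \<in> Y0 m" "i \<in> Y0 m" "i \<noteq> k"
  shows "Dij m n t k i (gen m i) = wscale (-1) (partial k :: 'a vf)"
proof -
  have "k \<in> Y m n" "i \<in> Y m n" using assms by (auto simp: Y_def)
  with assms show ?thesis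
    by (simp add: Dij_hom[OF gen_in_Lam_hom[OF assms(1,2)]] der_gen tau_simps ksign_def
        fun_eq_iff wscale_def lscale_def fD_def)
qed

lemma Dij_gen_odd:
  assumes "CHAR('a::field) > 2" "\<forall>i\<in>Y0 m. t i \<ge> 1" "k \<in> Y0 m" "l \<in> Y1 m n"
  shows "Dij m n t k l (gen m k) = (partial l :: 'a vf)"
proof -
  have "k \<in> Y m n" "l \<in> Y m n" "k \<noteq> l" using assms odd_not_even by (auto simp: Y_def)
  with assms show ?thesis
    by (simp add: Dij_hom[OF gen_in_Lam_hom[OF assms(1,2)]] der_gen tau_simps ksign_def
        fun_eq_iff wscale_def lscale_def fD_def)
qed

lemma lmul_gen_gen_in_Lam_hom:
  assumes "CHAR('a::field) > 2" "\<forall>i\<in>Y0 m. t i \<ge> 1" "k \<in> Y0 m" "l \<in> Y1 m n"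
  shows "(lmul m n t (gen m k) (gen m l) :: 'a lam) \<in> Lam_hom m n t 1"
proof -
  have "(\<lambda>j. if j = k then 1 else 0, {l}) \<in> mbasis CHAR('a) m n t"
    using assms by (simp add: mbasis_def unit_in_expo)
  from monomial_in_Lam_hom[OF this] show ?thesis
    by (simp add: lmul_gen_gen[OF assms] mpar_def)
qed

text \<open>The product of an even and an odd generator is odd, so the first sign in
  \<open>Dij\<close> is -1 and cancels the leading minus.\<close>

lemma Dij_torus:
  assumes "CHAR('a::field) > 2" "\<forall>i\<in>Y0 m. t i \<ge> 1" "k \<in> Y0 m" "l \<in> Y1 m n"
  shows "Dij m n t k l (lmul m n t (gen m k) (gen m l)) = (torus m k l :: 'a vf)"
proof -
  let ?f = "lmul m n t (gen m k) (gen m l) :: 'a lam"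
  note f = lmul_gen_gen_in_Lam_hom[OF assms] and F = Lam_homD[OF lmul_gen_gen_in_Lam_hom[OF assms]]
  have l: "l \<notin> Y0 m" "l \<noteq> k" using assms odd_not_even by blast+
  have *: "\<alpha>(k := Suc (\<alpha> k)) = (\<lambda>j. if j = k then 1 else 0) \<longleftrightarrow> \<alpha> = (\<lambda>_. 0)" for \<alpha>
    by (auto simp: fun_eq_iff)
  have "der m n t k ?f = gen m l"
    by (rule lam_eqI, subst der_apply_even[OF F assms(3)],
      unfold lmul_gen_gen[OF assms], unfold gen_odd[OF assms(4)] monomial_apply prod.inject *) simp
  moreover have "der m n t l ?f = gen m k"
  proof (rule lam_eqI)
    fix \<alpha> u
    have "insert l u = {l} \<longleftrightarrow> u = {}" if "l \<notin> u" using that by auto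
    then show "der m n t l ?f (\<alpha>, u) = gen m k (\<alpha>, u)"
      unfolding der_apply_odd[OF F l(1)] unfolding lmul_gen_gen[OF assms]
      unfolding gen_even[OF assms(3)] monomial_apply
      by auto
  qed
  ultimately show ?thesis
    using assms l
    by (simp add: Dij_hom[OF f] tau_simps ksign_def fun_eq_iff wscale_def lscale_def fD_def)
qed

text \<open>For even \<open>s\<close>, \<open>m \<ge> 2\<close> supplies another even
  \<open>i\<close>, and \<open>gen m i\<close> yields the negative of \<open>partial s\<close>; an
  odd \<open>s\<close> is reached from \<open>gen m 1\<close>.\<close>

lemma partial_in_S_hom:
  assumes "CHAR('a::field) > 2" "m \<ge> 2" "\<forall>i\<in>Y0 m. t i \<ge> 1" "s \<in> Y m n"
  shows "(partial s :: 'a vf) \<in> S_hom m n t (tau m s)"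
proof -
  have "(partial s :: 'a vf) \<in> S_alg m n t"
    using Y_cases[OF assms(4)]
  proof
    assume s: "s \<in> Y0 m"
    obtain i where i: "i \<in> Y0 m" "i \<noteq> s"
      using assms(2) that[of 1] that[of 2] by (fastforce simp: Y0_def)
    then have "i \<in> Y m n" by (simp add: Y_def)
    then have "Dij m n t s i (gen m i :: 'a lam) \<in> S_alg m n t"
      using assms(4) Lam_homD[OF gen_in_Lam_hom[OF assms(1,3)]]
      unfolding S_alg_def by (blast intro: W.span_base)
    then have "wscale (-1) (wscale (-1) (partial s :: 'a vf)) \<in> S_alg m n t"
      unfolding Dij_gen_even[OF assms(1,3) s i] S_alg_def by (rule W.span_scale)
    then show ?thesis
      by simp
  next
    assume s: "s \<in> Y1 m n"
    have "1 \<in> Y0 m" "1 \<in> Y m n" using assms(2) by (auto simp: Y0_def Y_def)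
    then have "Dij m n t 1 s (gen m 1 :: 'a lam) \<in> S_alg m n t"
      using assms(4) Lam_homD[OF gen_in_Lam_hom[OF assms(1,3)]]
      unfolding S_alg_def by (blast intro: W.span_base)
    then show ?thesis
      by (simp only: Dij_gen_odd[OF assms(1,3) \<open>1 \<in> Y0 m\<close> s])
  qed
  with partial_in_W_hom[OF assms(4)] show ?thesis
    by (simp add: S_hom_def)
qed

lemma torus_in_S_hom:
  assumes "CHAR('a::field) > 2" "\<forall>i\<in>Y0 m. t i \<ge> 1" "k \<in> Y0 m" "l \<in> Y1 m n"
  shows "(torus m k l :: 'a vf) \<in> S_hom m n t 0"
proof -
  have "k \<in> Y m n" "l \<in> Y m n" using assms by (auto simp: Y_def)
  then have "Dij m n t k l (lmul m n t (gen m k) (gen m l) :: 'a lam) \<in> S_alg m n t"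
    using Lam_homD[OF lmul_gen_gen_in_Lam_hom[OF assms]]
    unfolding S_alg_def by (blast intro: W.span_base)
  with torus_in_W_hom[OF assms] show ?thesis
    by (simp add: Dij_torus[OF assms] S_hom_def)
qed

subsection \<open>Skew-symmetric super-biderivations of \<open>S(m,n;t)\<close>\<close>

locale special_biderivation =
  fixes m n :: nat and t :: "nat \<Rightarrow> nat" and \<gamma> :: bit
    and \<phi> :: "'a::field vf \<Rightarrow> 'a vf \<Rightarrow> 'a vf"
  assumes char: "CHAR('a) > 2" and m2: "m \<ge> 2" and t1: "\<forall>i\<in>Y0 m. t i \<ge> 1"
    and bider: "skew_super_biderivation wscale (S_alg m n t) (S_hom m n t) (bracket m n t) \<gamma> \<phi>"
begin

abbreviation "br \<equiv> bracket m n t :: 'a vf \<Rightarrow> 'a vf \<Rightarrow> 'a vf"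
abbreviation "S \<equiv> S_hom m n t :: bit \<Rightarrow> 'a vf set"

lemma S_W: "x \<in> S a \<Longrightarrow> x \<in> W_hom m n t a"
  by (simp add: S_hom_def)

lemma phi_in_S: "x \<in> S a \<Longrightarrow> y \<in> S b \<Longrightarrow> \<phi> x y \<in> S (a + b + \<gamma>)"
  using bider unfolding skew_super_biderivation_def by blast

lemma phi_der: "x \<in> S a \<Longrightarrow> y \<in> S b \<Longrightarrow> z \<in> S c \<Longrightarrow>
    \<phi> x (br y z) = br (\<phi> x y) z + wscale (ksign ((\<gamma> + a) * b)) (br y (\<phi> x z))"
  using bider unfolding skew_super_biderivation_def by blast

lemma phi_skew: "x \<in> S a \<Longrightarrow> y \<in> S b \<Longrightarrow>
    \<phi> x y = - wscale (ksign (\<gamma> * a + \<gamma> * b + a * b)) (\<phi> y x)"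
  using bider unfolding skew_super_biderivation_def by blast

lemma phi_scale: "x \<in> S a \<Longrightarrow> y \<in> S b \<Longrightarrow> \<phi> x (wscale c y) = wscale c (\<phi> x y)"
  using bider unfolding skew_super_biderivation_def bilinear_on_def S_hom_def by blast

lemma phi_zero:
  assumes "x \<in> S a"
  shows "\<phi> x 0 = 0"
proof -
  have "0 \<in> S 0"
    unfolding S_hom_def S_alg_def using W.span_zero zero_in_W_hom by blast
  from phi_scale[OF assms this, of 0] show ?thesis
    by (simp only: W.scale_zero_left)
qed

lemma two_neq_zero: "(2::'a) \<noteq> 0"
proof
  assume "(2::'a) = 0"
  then have "of_nat 2 = (0::'a)" by simp
  then have "CHAR('a) dvd 2" by (simp only: of_nat_eq_0_iff_char_dvd)
  then show False using char by (auto dest: dvd_imp_le)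
qed

lemma ksign_0 [simp]: "ksign 0 = 1"
  by (simp add: ksign_def)

text \<open>For even \<open>x\<close> the skew-symmetry sign is trivial whatever
  \<open>\<gamma>\<close> is, so \<open>\<phi> x x\<close> is its own negative, and 2 is
  invertible.\<close>

lemma phi_self:
  assumes "x \<in> S 0"
  shows "\<phi> x x = 0"
proof (rule ext, rule ext)
  fix r b
  have "\<phi> x x = - \<phi> x x"
    using phi_skew[OF assms assms] unfolding mult_zero_right add_0_right ksign_0 W.scale_one .
  then have "\<phi> x x r b = - \<phi> x x r b" by (metis uminus_apply)
  then have "2 * \<phi> x x r b = 0" unfolding mult_2 eq_neg_iff_add_eq_0 .
  then show "\<phi> x x r b = 0 r b" using two_neq_zero by simp
qed

lemma bracket_even_right:
  assumes "X \<in> W_hom m n t d" "Z \<in> W_hom m n t 0"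
  shows "br X Z = - br Z X"
  using bracket_skew[OF assms] by simp

section \<open>The value \<open>v\<close> of \<open>\<phi>\<close> at a fixed torus element and
  \<open>D k\<close>\<close>

context
  fixes k l
  assumes k: "k \<in> Y0 m" and l: "l \<in> Y1 m n"
begin

abbreviation h where "h \<equiv> torus m k l :: 'a vf"
abbreviation D where "D \<equiv> partial :: nat \<Rightarrow> 'a vf"
abbreviation w where "w \<equiv> weight k l :: nat \<Rightarrow> mon \<Rightarrow> 'a"
abbreviation \<beta> where "\<beta> s \<equiv> of_bool (s = k) + of_bool (s = l) :: 'a"
abbreviation v where "v \<equiv> \<phi> h (D k)"

lemma k_Y: "k \<in> Y m n" and l_Y: "l \<in> Y m n" and kl: "k \<noteq> l" and tau_k: "tau m k = 0"
  using k l odd_not_even by (auto simp: Y_def tau_simps)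

lemma h_S: "h \<in> S 0"
  by (rule torus_in_S_hom[OF char t1 k l])

lemma D_S: "s \<in> Y m n \<Longrightarrow> D s \<in> S (tau m s)"
  by (rule partial_in_S_hom[OF char m2 t1])

lemma Dk_S: "D k \<in> S 0"
  using D_S[OF k_Y] by (simp add: tau_k)

lemma br_h: "X \<in> W_hom m n t e \<Longrightarrow> br h X r b = w r b * X r b"
  by (rule bracket_torus[OF char t1 k l])

lemma br_hD: "s \<in> Y m n \<Longrightarrow> br h (D s) = wscale (- \<beta> s) (D s)"
  by (rule bracket_torus_partial[OF char t1 k l])

lemma br_Dh: "s \<in> Y m n \<Longrightarrow> br (D s) h = wscale (\<beta> s) (D s)"
  using bracket_even_right[OF S_W[OF D_S] S_W[OF h_S]]
  by (simp add: br_hD fun_eq_iff wscale_def lscale_def)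

lemma v_S: "v \<in> S \<gamma>"
  using phi_in_S[OF h_S Dk_S] by simp

text \<open>As \<open>br h (D k) = - D k\<close> and \<open>\<phi> h h = 0\<close>, the derivation
  rule gives \<open>br h v = - v\<close>.\<close>

lemma v_weight: "(w r b + 1) * v r b = 0"
proof -
  have "- v = \<phi> h (br h (D k))"
    using phi_scale[OF h_S Dk_S, of "-1"] k_Y kl
    by (simp add: br_hD)
  also have "\<dots> = br h v"
    using phi_der[OF h_S h_S Dk_S] by (simp add: phi_self[OF h_S] bracket_zero[OF S_W[OF Dk_S]])
  finally have eq: "- v r b = w r b * v r b"
    using br_h[OF S_W[OF v_S]] by (metis uminus_apply)
  then show ?thesis by (simp add: distrib_right flip: eq)
qed

text \<open>The argument runs at one coefficient \<open>r\<close>, \<open>b\<close> at a time, where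
  bracketing with \<open>h\<close> is multiplication by the scalar \<open>w r b\<close>.\<close>

lemma der_v:
  assumes s: "s \<in> Y m n" and r: "r \<in> Y m n"
  shows "der m n t s (v r) = 0"
proof (rule ext)
  fix b
  \<comment> \<open>The same sign arises from moving \<open>\<phi>\<close> past \<open>D s\<close>,
    from skew-symmetry of \<open>\<phi>\<close> against an even argument, and from exchanging
    \<open>v\<close> and \<open>D s\<close> in the bracket.\<close>
  define \<kappa> :: 'a where "\<kappa> = ksign (\<gamma> * tau m s)"
  have \<kappa>2: "\<kappa> * \<kappa> = 1" unfolding \<kappa>_def by (rule ksign_square)
  define q where "q = \<kappa> * der m n t s (v r) b"
  define z where "z = \<phi> (D k) (D s)"
  define y where "y = \<phi> h (D s)"
  note Ds = D_S[OF s]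
  have zS: "z \<in> S (tau m s + \<gamma>)"
    using phi_in_S[OF Dk_S Ds] by (simp add: z_def)
  have yS: "y \<in> S (tau m s + \<gamma>)"
    using phi_in_S[OF h_S Ds] by (simp add: y_def)
  have br_zh: "br z h = - br h z"
    by (rule bracket_even_right[OF S_W[OF zS] S_W[OF h_S]])

  \<comment> \<open>First expansion, of \<open>\<phi> (D k) (br (D s) h)\<close>.\<close>
  have "wscale (\<beta> s) z = \<phi> (D k) (br (D s) h)"
    by (simp only: br_Dh[OF s] phi_scale[OF Dk_S Ds] z_def)
  also have "\<dots> = br z h + wscale \<kappa> (br (D s) (\<phi> (D k) h))"
    unfolding phi_der[OF Dk_S Ds h_S] z_def \<kappa>_def by simp
  finally have "wscale (\<beta> s) z r b = (- br h z + wscale \<kappa> (br (D s) (\<phi> (D k) h))) r b"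
    by (simp only: br_zh)
  then have 1: "\<beta> s * z r b = - (w r b * z r b) + \<kappa> * br (D s) (\<phi> (D k) h) r b"
    by (simp only: plus_fun_apply uminus_apply wscale_def lscale_def br_h[OF S_W[OF zS]])
  have "br (D s) (\<phi> (D k) h) r b = - der m n t s (v r) b"
  proof -
    have "\<phi> (D k) h = - v" using phi_skew[OF Dk_S h_S] by simp
    moreover have "\<phi> (D k) h \<in> S \<gamma>" using phi_in_S[OF Dk_S h_S] by simp
    ultimately show ?thesis
      using bracket_partial[OF s S_W, of "\<phi> (D k) h" \<gamma> r] r by (simp add: der_uminus)
  qed
  with 1 have eq1: "\<beta> s * z r b = - (w r b * z r b) - q"
    by (simp add: q_def)

  \<comment> \<open>Second expansion, using \<open>br (D k) h = D k\<close>; skew-symmetry then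
    expresses everything through \<open>z\<close> and \<open>y\<close>.\<close>
  have "\<phi> (D s) (D k) = \<phi> (D s) (br (D k) h)"
    using br_Dh[OF k_Y] kl by simp
  also have "\<dots> = br (\<phi> (D s) (D k)) h + br (D k) (\<phi> (D s) h)"
    using phi_der[OF Ds Dk_S h_S] by simp
  finally have 2: "\<phi> (D s) (D k) = br (\<phi> (D s) (D k)) h + br (D k) (\<phi> (D s) h)" .
  have sk: "\<phi> (D s) (D k) = - wscale \<kappa> z" "\<phi> (D s) h = - wscale \<kappa> y"
    using phi_skew[OF Ds Dk_S] phi_skew[OF Ds h_S] by (simp_all only: \<kappa>_def z_def y_def mult_zero_right add_0_right)
  have skS: "\<phi> (D s) (D k) \<in> S (tau m s + \<gamma>)" "\<phi> (D s) h \<in> S (tau m s + \<gamma>)"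
    using phi_in_S[OF Ds Dk_S] phi_in_S[OF Ds h_S] by simp_all
  have L: "\<phi> (D s) (D k) r b = - (\<kappa> * z r b)"
    by (simp only: sk(1) uminus_apply wscale_def lscale_def)
  have "br (\<phi> (D s) (D k)) h r b = \<kappa> * (w r b * z r b)"
    using br_h[OF S_W[OF skS(1)], of r b] L
    by (simp only: bracket_even_right[OF S_W[OF skS(1)] S_W[OF h_S]] uminus_apply) simp
  moreover have "br (D k) (\<phi> (D s) h) r b = - (\<kappa> * der m n t k (y r) b)"
  proof -
    have "\<phi> (D s) h r = - lscale \<kappa> (y r)"
      by (simp only: sk(2) uminus_apply wscale_def)
    then show ?thesis
      using bracket_partial[OF k_Y S_W[OF skS(2)], of r] r
      by (simp only: if_True der_uminus der_lscale uminus_apply) (simp only: lscale_def)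
  qed
  ultimately have "- (\<kappa> * z r b) = \<kappa> * (w r b * z r b) - \<kappa> * der m n t k (y r) b"
    using fun_cong[OF fun_cong[OF 2, of r], of b] L
    by (simp only: plus_fun_apply diff_conv_add_uminus)
  then have "\<kappa> * (- z r b) = \<kappa> * (w r b * z r b - der m n t k (y r) b)"
    by (simp only: mult_minus_right right_diff_distrib)
  moreover have "\<kappa> \<noteq> 0" using \<kappa>2 by auto
  ultimately have "- z r b = w r b * z r b - der m n t k (y r) b"
    by (metis mult_cancel_left)
  then have 3: "z r b = - (w r b * z r b) + der m n t k (y r) b"
    by (metis add.commute add_uminus_conv_diff minus_diff_eq minus_minus)

  \<comment> \<open>Third expansion, from the commuting pair \<open>D k\<close>, \<open>D s\<close>:
    it identifies the derivative of \<open>y\<close> along \<open>D k\<close> with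
    \<open>q\<close>.\<close>
  have "0 = br v (D s) + br (D k) y"
  proof -
    have "\<phi> h (br (D k) (D s)) = 0"
      unfolding bracket_partial_partial[OF k_Y s] by (rule phi_zero[OF h_S])
    then show ?thesis using phi_der[OF h_S Dk_S Ds] by (simp add: y_def)
  qed
  from fun_cong[OF fun_cong[OF this, of r], of b] have "0 = br v (D s) r b + br (D k) y r b"
    by (simp only: plus_fun_apply zero_fun_apply)
  also have "br v (D s) r b = - q"
    by (simp only: bracket_skew[OF S_W[OF v_S] S_W[OF Ds]] uminus_apply wscale_def lscale_def
        bracket_partial[OF s S_W[OF v_S]] r if_True q_def \<kappa>_def)
  also have "br (D k) y r b = der m n t k (y r) b"
    using r by (simp add: bracket_partial[OF k_Y S_W[OF yS]])
  finally have eq2: "z r b = - (w r b * z r b) + q"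
    using 3 by simp

  \<comment> \<open>A nonzero \<open>q\<close> comes from a coefficient of \<open>v\<close> one step
    above \<open>b\<close>; its weight is \<open>w r b + \<beta> s\<close>, which must be
    -1.\<close>
  have q_weight: "q = 0 \<or> w r b + \<beta> s + 1 = 0"
  proof -
    obtain \<alpha> u where b: "b = (\<alpha>, u)" by fastforce
    note L = W_hom_Lam[OF S_W[OF v_S], of r]
    from Y_cases[OF s] show ?thesis
    proof
      assume "s \<in> Y0 m"
      moreover from this have "s \<noteq> l" using l odd_not_even by blast
      ultimately show ?thesis
        using v_weight[of r "(\<alpha>(s := Suc (\<alpha> s)), u)"]
        by (auto simp: q_def b der_apply_even[OF L] weight_der_even)
    next
      assume "s \<in> Y1 m n"
      then have "s \<notin> Y0 m" "s \<noteq> k" using k odd_not_even by blast+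
      then show ?thesis
        using v_weight[of r "(\<alpha>, insert s u)"]
        by (auto simp: q_def b der_apply_odd[OF L] weight_der_odd)
    qed
  qed
  have "q = 0"
  proof (rule ccontr)
    assume "q \<noteq> 0"
    with q_weight have W: "w r b = - 1 - \<beta> s" by (simp add: algebra_simps eq_neg_iff_add_eq_0)
    \<comment> \<open>If \<open>\<beta> s = 0\<close>, then \<open>w r b = - 1\<close> and
      \<open>eq2\<close> reads \<open>z = z + q\<close> at this coefficient. If
      \<open>\<beta> s = 1\<close>, the left sides of \<open>eq1\<close> and \<open>eq2\<close>
      agree, so \<open>2 * q = 0\<close>.\<close>
    have "\<beta> s = 0 \<or> \<beta> s = 1" using kl by auto
    then show False
    proof
      assume "\<beta> s = 0"
      then show False using eq2 W \<open>q \<noteq> 0\<close> by simp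
    next
      assume \<beta>: "\<beta> s = 1"
      have "- (w r b * z r b) - q = - (w r b * z r b) + q"
        using eq1[unfolded \<beta> mult_1_left, symmetric] eq2 by (rule trans)
      then have "- q = q" by (simp only: diff_conv_add_uminus add_left_cancel)
      then have "2 * q = q + - q" by (simp only: mult_2)
      then have "2 * q = 0" by (simp only: add.right_inverse)
      then show False using \<open>q \<noteq> 0\<close> two_neq_zero by simp
    qed
  qed
  then have "\<kappa> * (\<kappa> * der m n t s (v r) b) = 0" by (simp add: q_def)
  then show "der m n t s (v r) b = 0 b" by (simp add: \<kappa>2 flip: mult.assoc)
qed

text \<open>All derivatives of the coefficients of \<open>v\<close> vanish, so these are constants;
  a constant at \<open>r\<close> has weight \<open>- \<beta> r\<close>, which is -1 only for
  \<open>r = k\<close> or \<open>r = l\<close>.\<close>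

lemma v_const:
  assumes "v r b \<noteq> 0"
  shows "b = (\<lambda>_. 0, {})" "r = k \<or> r = l"
proof -
  have r: "r \<in> Y m n"
    using assms S_W[OF v_S] by (auto simp: W_hom_def)
  show b: "b = (\<lambda>_. 0, {})"
    using const_if_der_zero[OF W_hom_Lam[OF S_W[OF v_S]] der_v assms] r by blast
  show "r = k \<or> r = l"
    using v_weight[of r b] assms by (auto simp: b weight_def)
qed

text \<open>A second torus element sharing \<open>l\<close> but not \<open>k\<close> separates the
  two remaining terms: it commutes with \<open>D k\<close> but has eigenvalue -1 on
  \<open>D l\<close>.\<close>

lemma v_odd_coefficient: "v l (\<lambda>_. 0, {}) = 0"
proof -
  obtain k' where k': "k' \<in> Y0 m" "k' \<noteq> k"
    using m2 that[of 1] that[of 2] by (fastforce simp: Y0_def)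
  then have k'l: "k' \<noteq> l" using l odd_not_even by blast
  let ?h' = "torus m k' l :: 'a vf" and ?e = "\<lambda>j. if j = k then Suc 0 else 0"
  define x where "x = \<phi> h ?h'"
  note h' = torus_in_S_hom[OF char t1 k'(1) l]
  note br_h' = bracket_torus[OF char t1 k'(1) l]
  have xS: "x \<in> S \<gamma>" using phi_in_S[OF h_S h'] by (simp add: x_def)
  have h'x: "\<phi> ?h' h = - x" using phi_skew[OF h' h_S] by (simp add: x_def)
  have h'xS: "- x \<in> S \<gamma>" using phi_in_S[OF h' h_S] by (simp add: h'x)
  \<comment> \<open>The two torus elements commute and \<open>\<phi> ?h' ?h' = 0\<close>, so
    \<open>x\<close> has \<open>?h'\<close>-weight 0; the monomial \<open>?e\<close> at index
    \<open>l\<close> has weight -1 and cannot occur in it.\<close>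
  have "0 = \<phi> ?h' (br ?h' h)"
    unfolding bracket_torus_torus[OF char t1 k k' l] by (rule phi_zero[OF h', symmetric])
  also have "\<dots> = br ?h' (- x)"
    using phi_der[OF h' h' h_S] by (simp add: phi_self[OF h'] bracket_zero[OF S_W[OF h_S]] h'x)
  finally have "weight k' l l (?e, {}) * (- x) l (?e, {}) = 0"
    using br_h'[OF S_W[OF h'xS], of l "(?e, {})"] by (metis zero_fun_apply)
  then have x0: "x l (?e, {}) = 0"
    using k' k'l by (simp add: weight_def)
  \<comment> \<open>The constant coefficient at \<open>l\<close> of this relation equates that
    absent coefficient of \<open>x\<close> with \<open>- v l (\<lambda>_. 0, {})\<close>.\<close>
  have "br ?h' (D k) = 0"
    using bracket_torus_partial[OF char t1 k'(1) l k_Y] k' kl by simp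
  then have "0 = \<phi> h (br ?h' (D k))"
    using phi_zero[OF h_S] by simp
  also have "\<dots> = - br (D k) x + br ?h' v"
    using phi_der[OF h_S h' Dk_S] bracket_even_right[OF S_W[OF xS] S_W[OF Dk_S]] by (simp add: x_def)
  finally have "br (D k) x l (\<lambda>_. 0, {}) = br ?h' v l (\<lambda>_. 0, {})"
    by (metis add_eq_0_iff2 minus_minus)
  also have "\<dots> = - v l (\<lambda>_. 0, {})"
    using k'l by (simp only: br_h'[OF S_W[OF v_S]]) (simp add: weight_def)
  also have "br (D k) x l (\<lambda>_. 0, {}) = x l ((\<lambda>_. 0)(k := Suc 0), {})"
    by (simp only: bracket_partial[OF k_Y S_W[OF xS]] l_Y if_True der_apply_even[OF W_hom_Lam[OF S_W[OF xS]] k])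
  also have "(\<lambda>_. 0)(k := Suc 0) = ?e" by auto
  finally have "x l (?e, {}) = - v l (\<lambda>_. 0, {})" .
  then show ?thesis unfolding x0 neg_0_equal_iff_equal by (rule sym)
qed

lemma v_eq: "v = wscale (v k (\<lambda>_. 0, {})) (D k)"
proof (rule ext, rule ext)
  fix r b
  have "v r b = (if r = k \<and> b = (\<lambda>_. 0, {}) then v k (\<lambda>_. 0, {}) else 0)"
    using v_const[of r b] v_odd_coefficient by metis
  then show "v r b = wscale (v k (\<lambda>_. 0, {})) (D k) r b"
    by (simp add: wscale_def lscale_def fD_def monomial_apply)
qed

text \<open>Bracketing with \<open>h\<close> negates \<open>D k\<close>, whence the minus sign in
  the factor; the claim needs the case \<open>c = -1\<close>.\<close>

lemma phi_eq_bracket: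
  "\<phi> h (wscale c (D k)) = wscale (- v k (\<lambda>_. 0, {})) (br h (wscale c (D k)))"
proof -
  have "wscale c (D k) \<in> W_hom m n t 0"
    by (rule wscale_in_W_hom[OF S_W[OF Dk_S]])
  from br_h[OF this] have "br h (wscale c (D k)) = wscale (-c) (D k)"
    using kl by (intro ext) (simp only:, simp add: wscale_def lscale_def fD_def monomial_apply weight_def)
  moreover have "\<phi> h (wscale c (D k)) = wscale c (wscale (v k (\<lambda>_. 0, {})) (D k))"
    unfolding phi_scale[OF h_S Dk_S] by (rule arg_cong[OF v_eq])
  ultimately show ?thesis
    by (simp only: W.scale_scale minus_mult_minus mult.commute)
qed

end

end

theorem lemma4p5:
  fixes m n :: nat and t :: "nat \<Rightarrow> nat"
    and \<gamma> :: bit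
    and \<phi> :: "'a::field vf \<Rightarrow> 'a vf \<Rightarrow> 'a vf"
  assumes "CHAR('a) > 2"
    and "m \<ge> 2" and "n \<ge> 2"
    and "\<forall>i\<in>Y0 m. t i \<ge> 1"
    and "skew_super_biderivation wscale (S_alg m n t) (S_hom m n t) (bracket m n t) \<gamma> \<phi>"
  shows "\<exists>l :: nat \<Rightarrow> nat \<Rightarrow> 'a.
    \<forall>k0\<in>Y0 m. \<forall>i0\<in>Y0 m. \<forall>k1\<in>Y1 m n. i0 \<noteq> k0 \<longrightarrow>
      \<phi> (Dij m n t k0 k1 (lmul m n t (gen m k0) (gen m k1))) (Dij m n t k0 i0 (gen m i0)) =
      wscale (l k0 k1)
        (bracket m n t (Dij m n t k0 k1 (lmul m n t (gen m k0) (gen m k1)))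
                       (Dij m n t k0 i0 (gen m i0)))"
proof -
  interpret special_biderivation m n t \<gamma> \<phi>
    using assms by unfold_locales
  show ?thesis
  proof (rule exI, intro ballI impI)
    fix k0 i0 k1
    assume k0: "k0 \<in> Y0 m" and i0: "i0 \<in> Y0 m" and k1: "k1 \<in> Y1 m n" and neq: "i0 \<noteq> k0"
    \<comment> \<open>The witness is free of \<open>i0\<close>, since
      \<open>Dij m n t k0 i0 (gen m i0)\<close> is the negative of \<open>partial k0\<close> for
      every admissible \<open>i0\<close>.\<close>
    show "\<phi> (Dij m n t k0 k1 (lmul m n t (gen m k0) (gen m k1))) (Dij m n t k0 i0 (gen m i0)) =
      wscale ((\<lambda>k l. - \<phi> (torus m k l) (partial k) k (\<lambda>_. 0, {})) k0 k1)
        (bracket m n t (Dij m n t k0 k1 (lmul m n t (gen m k0) (gen m k1)))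
                       (Dij m n t k0 i0 (gen m i0)))"
      unfolding Dij_torus[OF assms(1,4) k0 k1] Dij_gen_even[OF assms(1,4) k0 i0 neq]
      by (rule phi_eq_bracket[OF k0 k1])
  qed
qed

end
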